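(* Let $k = 2j$ for a positive integer $j$. Then there is a graph $G$ with $|V(G)| = 2^{k-1} + k - 2$ and $\textrm{RED:LD}(G) = k$.
   Context: $N(v)$ denotes the open neighborhood of $v$. A set $S \subseteq V(G)$ is a locating-dominating (LD) set if for all $u,v \in V(G)-S$: $N(v)\cap S \neq \varnothing$, and if $u \ne v$ then $N(v) \cap S \neq N(u) \cap S$. A RED:LD set is an LD set $S$ such that $S-\{v\}$ is an LD set for every $v \in S$. $\textrm{RED:LD}(G)$ denotes the minimum cardinality of a RED:LD set of $G$. *)

theory Defs
  imports "Graph_Theory.Pair_Digraph" "HOL-Library.Extended_Nat"
begin

text \<open>
  A finite simple graph is a \<^locale>\<open>pair_graph\<close>: a finite, loop-free, symmetric digraph whose
  arcs are ordered pairs of vertices, each edge being represented by its two arcs.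
\<close>

definition open_nbhd :: "'a pair_pre_digraph \<Rightarrow> 'a \<Rightarrow> 'a set" where
  "open_nbhd G v = {u \<in> pverts G. (v, u) \<in> parcs G}"

definition LD_set :: "'a pair_pre_digraph \<Rightarrow> 'a set \<Rightarrow> bool" where
  "LD_set G S \<longleftrightarrow> S \<subseteq> pverts G \<and>
     (\<forall>u \<in> pverts G - S. \<forall>v \<in> pverts G - S.
        open_nbhd G v \<inter> S \<noteq> {} \<and>
        (u \<noteq> v \<longrightarrow> open_nbhd G v \<inter> S \<noteq> open_nbhd G u \<inter> S))"

definition RED_LD_set :: "'a pair_pre_digraph \<Rightarrow> 'a set \<Rightarrow> bool" where
  "RED_LD_set G S \<longleftrightarrow> LD_set G S \<and> (\<forall>v \<in> S. LD_set G (S - {v}))"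

text \<open>
  Not every graph has a RED:LD set (one with an isolated vertex does not). Taking the infimum in
  \<^typ>\<open>enat\<close> gives the value \<open>\<infinity>\<close> in that case, so that a finite value
  always means that a RED:LD set of this minimum cardinality exists.
\<close>

definition RED_LD :: "'a pair_pre_digraph \<Rightarrow> enat" where
  "RED_LD G = (INF S \<in> {S. RED_LD_set G S}. enat (card S))"

end

theory Submission
  imports Defs
begin

text \<open>
  Deleting a vertex \<open>v\<close> from a RED:LD set \<open>S\<close> leaves an LD set, so the traces on \<open>S - {v}\<close> of
  the vertices outside it are distinct nonempty sets. Hence a graph with a RED:LD set of size
  \<open>m\<close> has at most \<open>2 ^ (m - 1) + m - 2\<close> vertices. For even \<open>k\<close> the bound is attained by a
  \<open>k\<close>-clique \<open>S\<close> together with one vertex for every nonempty proper subset of \<open>S\<close> of even size,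
  adjacent to exactly that subset. Sets of even size stay distinct when one element \<open>v\<close> is deleted
  from all of them; and since \<open>S\<close> itself has even size, the trace \<open>S - {v}\<close> of the clique vertex
  \<open>v\<close> also arises in this way, from the one nonempty even set that is not attached to a vertex.
\<close>

definition nbhd_trace :: "'a pair_pre_digraph \<Rightarrow> 'a set \<Rightarrow> 'a \<Rightarrow> 'a set" where
  "nbhd_trace G S u = open_nbhd G u \<inter> S"

lemma LD_set_iff_inj_on_nbhd_trace:
  "LD_set G S \<longleftrightarrow> S \<subseteq> pverts G \<and> inj_on (nbhd_trace G S) (pverts G - S) \<and>
     {} \<notin> nbhd_trace G S ` (pverts G - S)"
  unfolding LD_set_def inj_on_def nbhd_trace_def by blast

lemma LD_set_superset:
  assumes "LD_set G S" and "S \<subseteq> T" and "T \<subseteq> pverts G"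
  shows "LD_set G T"
proof -
  have trace_S: "nbhd_trace G S u = nbhd_trace G T u \<inter> S" for u
    using assms(2) unfolding nbhd_trace_def by blast
  have "inj_on (nbhd_trace G S) (pverts G - T)" "{} \<notin> nbhd_trace G S ` (pverts G - T)"
    using assms(1,2) unfolding LD_set_iff_inj_on_nbhd_trace by (blast intro: inj_on_subset)+
  then show ?thesis
    using assms(3) unfolding LD_set_iff_inj_on_nbhd_trace inj_on_def image_iff trace_S
    by (metis Int_empty_left)
qed

lemma RED_LD_setI:
  assumes "S \<subseteq> pverts G" and "S \<noteq> {}" and "\<And>v. v \<in> S \<Longrightarrow> LD_set G (S - {v})"
  shows "RED_LD_set G S"
  using assms LD_set_superset unfolding RED_LD_set_def by blast

lemma LD_set_card_bound:
  assumes "finite (pverts G)" and "LD_set G S"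
  shows "card (pverts G) + 1 \<le> 2 ^ card S + card S"
proof -
  have sub: "S \<subseteq> pverts G" and inj: "inj_on (nbhd_trace G S) (pverts G - S)"
    and nonempty: "{} \<notin> nbhd_trace G S ` (pverts G - S)"
    using assms(2) by (simp_all add: LD_set_iff_inj_on_nbhd_trace)
  have "finite S"
    using sub assms(1) by (rule finite_subset)
  have "nbhd_trace G S ` (pverts G - S) \<subseteq> Pow S - {{}}"
    using nonempty by (auto simp: nbhd_trace_def)
  with inj have "card (pverts G - S) \<le> card (Pow S - {{}})"
    using \<open>finite S\<close> by (intro card_inj_on_le) auto
  also have "\<dots> = 2 ^ card S - 1"
    using \<open>finite S\<close> by (simp add: card_Pow)
  finally have "card (pverts G - S) + 1 \<le> 2 ^ card S"
    by (simp add: Nat.le_diff_conv2)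
  moreover have "card (pverts G) = card (pverts G - S) + card S"
    using \<open>finite S\<close> sub assms(1) by (simp add: card_Diff_subset card_mono)
  ultimately show ?thesis by linarith
qed

lemma RED_LD_set_card_bound:
  assumes "finite (pverts G)" and "pverts G \<noteq> {}" and "RED_LD_set G S"
  shows "card (pverts G) + 2 \<le> 2 ^ (card S - 1) + card S"
proof -
  have LD: "LD_set G S" and LD_Diff: "\<And>v. v \<in> S \<Longrightarrow> LD_set G (S - {v})"
    using assms(3) by (simp_all add: RED_LD_set_def)
  have "finite S"
    using LD assms(1) finite_subset by (auto simp: LD_set_def)
  have "S \<noteq> {}"
    using LD assms(2) by (auto simp: LD_set_def)
  then obtain v where "v \<in> S" by blast
  then have "card S \<ge> 1"
    using \<open>finite S\<close> by (auto simp: Suc_le_eq card_gt_0_iff)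
  then show ?thesis
    using LD_set_card_bound[OF assms(1) LD_Diff[OF \<open>v \<in> S\<close>]] \<open>v \<in> S\<close> by simp
qed

lemma RED_LD_eq_if_card_bound_attained:
  assumes "finite (pverts G)" and "RED_LD_set G S"
    and "card (pverts G) + 2 = 2 ^ (card S - 1) + card S"
  shows "RED_LD G = enat (card S)"
proof -
  have "S \<noteq> {}"
    using assms(3) by auto
  then have "pverts G \<noteq> {}"
    using assms(2) by (auto simp: RED_LD_set_def LD_set_def)
  have minimal: "card S \<le> card T" if "RED_LD_set G T" for T
  proof (rule ccontr)
    assume "\<not> card S \<le> card T"
    then have "(2::nat) ^ (card T - 1) + card T < 2 ^ (card S - 1) + card S"
      by (intro add_le_less_mono power_increasing) auto
    then show False
      using RED_LD_set_card_bound[OF assms(1) \<open>pverts G \<noteq> {}\<close> that] assms(3) by simp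
  qed
  show ?thesis
    unfolding RED_LD_def
  proof (rule antisym)
    show "(INF T\<in>{T. RED_LD_set G T}. enat (card T)) \<le> enat (card S)"
      using assms(2) by (intro INF_lower) simp
    show "enat (card S) \<le> (INF T\<in>{T. RED_LD_set G T}. enat (card T))"
      using minimal by (intro INF_greatest) simp
  qed
qed

definition even_subsets :: "'a set \<Rightarrow> 'a set set" where
  "even_subsets A = {B. B \<subseteq> A \<and> even (card B)}"

lemma finite_even_subsets [simp]: "finite A \<Longrightarrow> finite (even_subsets A)"
  by (simp add: even_subsets_def)

lemma empty_in_even_subsets [simp]: "{} \<in> even_subsets A"
  by (simp add: even_subsets_def)

lemma card_even_subsets:
  assumes "finite A" and "A \<noteq> {}"
  shows "card (even_subsets A) = 2 ^ (card A - 1)"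
proof -
  let ?odd = "{B. B \<subseteq> A \<and> odd (card B)}"
  have "card (even_subsets A) = card ?odd"
    using card_subsupersets_even_odd[of A "{}"] assms by (simp add: even_subsets_def psubset_eq)
  moreover have "card (even_subsets A \<union> ?odd) = card (even_subsets A) + card ?odd"
    using assms(1) by (intro card_Un_disjoint) (auto simp: even_subsets_def)
  moreover have "even_subsets A \<union> ?odd = Pow A"
    by (auto simp: even_subsets_def)
  moreover have "(2::nat) ^ card A = 2 * 2 ^ (card A - 1)"
    using assms by (simp add: card_gt_0_iff flip: power_Suc)
  ultimately show ?thesis
    using assms(1) by (simp add: card_Pow)
qed

lemma inj_on_Diff_singleton_even_subsets:
  assumes "finite A"
  shows "inj_on (\<lambda>B. B - {v}) (even_subsets A)"
proof (rule inj_onI)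
  fix B C
  assume mem: "B \<in> even_subsets A" "C \<in> even_subsets A" and eq: "B - {v} = C - {v}"
  have odd_iff: "odd (card (D - {v})) \<longleftrightarrow> v \<in> D" if "D \<in> even_subsets A" for D
  proof -
    have "finite D" "even (card D)"
      using that assms finite_subset by (auto simp: even_subsets_def)
    then show ?thesis
      by (metis Diff_empty Diff_insert0 card_Suc_Diff1 even_Suc)
  qed
  have "v \<in> B \<longleftrightarrow> v \<in> C"
    using odd_iff[OF mem(1)] odd_iff[OF mem(2)] eq by simp
  with eq show "B = C" by blast
qed

locale clique_extension =
  fixes S W :: "'a set" and f :: "'a \<Rightarrow> 'a set"
  assumes finite_clique: "finite S" and finite_attached: "finite W"
    and disjoint: "S \<inter> W = {}" and nbhd_subset: "w \<in> W \<Longrightarrow> f w \<subseteq> S"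
begin

definition graph :: "'a pair_pre_digraph" where
  "graph = \<lparr>pverts = S \<union> W,
     parcs = {(u, v). u \<in> S \<and> v \<in> S \<and> u \<noteq> v} \<union> {(u, w). w \<in> W \<and> u \<in> f w} \<union>
       {(w, u). w \<in> W \<and> u \<in> f w}\<rparr>"

lemma pverts_graph [simp]: "pverts graph = S \<union> W"
  by (simp add: graph_def)

lemma pair_graph_clique_extension: "pair_graph graph"
proof -
  have "parcs graph \<subseteq> (S \<union> W) \<times> (S \<union> W)"
    using nbhd_subset by (auto simp: graph_def)
  then have "finite (parcs graph)"
    by (rule finite_subset) (simp add: finite_clique finite_attached)
  then show ?thesis
    using disjoint finite_clique finite_attached
    by unfold_locales (auto simp: graph_def symmetric_def sym_def dest: subsetD[OF nbhd_subset])
qed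

lemma nbhd_trace_clique:
  assumes "u \<in> S" and "T \<subseteq> S"
  shows "nbhd_trace graph T u = T - {u}"
  using assms disjoint by (auto simp: nbhd_trace_def open_nbhd_def graph_def)

lemma nbhd_trace_attached:
  assumes "w \<in> W" and "T \<subseteq> S"
  shows "nbhd_trace graph T w = f w \<inter> T"
  using assms disjoint by (auto simp: nbhd_trace_def open_nbhd_def graph_def)

lemma RED_LD_set_clique:
  assumes "even (card S)" and "S \<noteq> {}"
    and "inj_on f W" and "f ` W \<subseteq> even_subsets S - {{}, S}"
  shows "RED_LD_set graph S"
proof (rule RED_LD_setI)
  fix v assume "v \<in> S"
  define g where "g = f(v := S)"
  have "v \<notin> W"
    using \<open>v \<in> S\<close> disjoint by blast
  have trace: "nbhd_trace graph (S - {v}) u = g u - {v}" if "u \<in> insert v W" for u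
    using that \<open>v \<in> S\<close> nbhd_subset[of u] by (auto simp: g_def nbhd_trace_clique nbhd_trace_attached)
  have g_even: "g ` insert v W \<subseteq> even_subsets S - {{}}"
    using assms \<open>v \<notin> W\<close> by (auto simp: g_def even_subsets_def)
  have inj_Diff: "inj_on (\<lambda>B. B - {v}) (even_subsets S)"
    using finite_clique by (rule inj_on_Diff_singleton_even_subsets)
  then have "inj_on (\<lambda>B. B - {v}) (g ` insert v W)"
    by (rule inj_on_subset) (use g_even in blast)
  moreover have "inj_on g (insert v W)"
    using assms \<open>v \<notin> W\<close> by (auto simp: g_def inj_on_def)
  ultimately have "inj_on ((\<lambda>B. B - {v}) \<circ> g) (insert v W)"
    by (intro comp_inj_on)
  then have "inj_on (nbhd_trace graph (S - {v})) (insert v W)"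
    using trace by (simp add: inj_on_def)
  moreover have "g u - {v} \<noteq> {}" if "u \<in> insert v W" for u
    using inj_onD[OF inj_Diff, of "g u" "{}"] g_even that by auto
  then have "{} \<notin> nbhd_trace graph (S - {v}) ` insert v W"
    using trace by force
  moreover have "pverts graph - (S - {v}) = insert v W"
    using \<open>v \<in> S\<close> disjoint by auto
  ultimately show "LD_set graph (S - {v})"
    unfolding LD_set_iff_inj_on_nbhd_trace by auto
qed (use assms in auto)

lemma card_pverts_graph_eq_if_bij_betw:
  assumes "even (card S)" and "S \<noteq> {}" and "bij_betw f W (even_subsets S - {{}, S})"
  shows "card (pverts graph) + 2 = 2 ^ (card S - 1) + card S"
proof -
  have "{{}, S} \<subseteq> even_subsets S"
    using assms(1) by (auto simp: even_subsets_def)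
  then have "card (even_subsets S - {{}, S}) + card {{}, S} = card (even_subsets S)"
    using card_mono[of "even_subsets S" "{{}, S}"] finite_clique by (simp add: card_Diff_subset)
  then have "card W + 2 = 2 ^ (card S - 1)"
    using assms(2) finite_clique bij_betw_same_card[OF assms(3)] by (simp add: card_even_subsets)
  then show ?thesis
    using finite_clique finite_attached disjoint by (simp add: card_Un_disjoint)
qed

end

theorem theorem4:
  fixes j k :: nat
  assumes "j > 0" and "k = 2 * j"
  shows "\<exists>G :: nat pair_pre_digraph.
           pair_graph G \<and> card (pverts G) = 2 ^ (k - 1) + k - 2 \<and> RED_LD G = enat k"
proof -
  define S where "S = {..<k}"
  define E where "E = even_subsets S - {{}, S}"
  define W where "W = {k..<k + card E}"
  have card_S: "card S = k" and even_S: "even (card S)" and nonempty_S: "S \<noteq> {}"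
    using assms by (auto simp: S_def lessThan_empty_iff)
  obtain f where f_bij: "bij_betw f W E"
    using finite_same_card_bij[of W E] by (auto simp: S_def E_def W_def)
  interpret clique_extension S W f
    using bij_betwE[OF f_bij] by unfold_locales (auto simp: S_def E_def W_def even_subsets_def)
  have order: "card (pverts graph) + 2 = 2 ^ (card S - 1) + card S"
    using even_S nonempty_S f_bij unfolding E_def by (rule card_pverts_graph_eq_if_bij_betw)
  have "RED_LD_set graph S"
    using even_S nonempty_S f_bij by (intro RED_LD_set_clique) (auto simp: E_def bij_betw_def)
  with order have "RED_LD graph = enat (card S)"
    by (intro RED_LD_eq_if_card_bound_attained) (auto simp: finite_clique finite_attached)
  moreover have "card (pverts graph) = 2 ^ (k - 1) + k - 2"
    using order unfolding card_S by linarith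
  ultimately show ?thesis
    using pair_graph_clique_extension card_S by blast
qed

end
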